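(* Let $H$ be a Hopf algebra and let $B=A^{coH}\subseteq A$ be an $H$-Hopf--Galois extension with translation map $\tau$. The set $$\mathrm{Aut}_B(A):=\{\Phi:A\to A \text{ morphism of right } H\text{-comodule algebras}\mid \Phi|_B=\mathrm{id}_B\}$$ is a group with respect to the composition of maps $\Phi\cdot\Psi:=\Psi\circ\Phi$ for all $\Phi,\Psi\in\mathrm{Aut}_B(A)$. For $\Phi\in \mathrm{Aut}_B(A)$ its inverse $\Phi^{-1}\in\mathrm{Aut}_B(A)$ is the map $$\Phi^{-1}=m\circ(\mathrm{id}\otimes m)\circ(\mathrm{id}\otimes\Phi\otimes_B\mathrm{id})\circ(\mathrm{id}\otimes\tau)\circ\delta^A:\ A\to A,\qquad a\mapsto a_{(0)}\,\Phi\big(a_{(1)}{}^{<1>}\big)\,a_{(1)}{}^{<2>}.$$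
   Context: $\Bbbk$ is a field, or the ring of formal power series in a variable over a field; $\otimes$ is over $\Bbbk$; all algebras are unital and associative over $\Bbbk$ and algebra maps are unital. A right $H$-comodule algebra $A$ has coaction $\delta^A:A\to A\otimes H$, $\delta^A(a)=a_{(0)}\otimes a_{(1)}$ (sum understood), which is an algebra map. A morphism of right $H$-comodule algebras is an algebra map that is also an $H$-comodule map. The subalgebra of coinvariants is $B=A^{coH}=\{b\in A\mid \delta^A(b)=b\otimes 1_H\}$. The extension $B\subseteq A$ is $H$-Hopf--Galois if the canonical map $\chi:A\otimes_BA\to A\otimes H$, $a'\otimes_Ba\mapsto a'a_{(0)}\otimes a_{(1)}$, is bijective. The translation map is $\tau:H\to A\otimes_BA$, $\tau(h)=\chi^{-1}(1_A\otimes h)=:h^{<1>}\otimes_B h^{<2>}$ (sum understood). The map $m$ denotes the multiplication of $A$, also the one induced on $A\otimes_BA$. *)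

theory Defs
  imports
    "HOL-Library.Poly_Mapping"
    "HOL-Computational_Algebra.Formal_Power_Series"
    "HOL-Algebra.Group"
begin

section \<open>Free modules and their quotients\<close>

text \<open>
  The free \<open>'k\<close>-module on a type \<open>'x\<close> is \<open>'x \<Rightarrow>\<^sub>0 'k\<close>, with basis vectors \<open>fgen x\<close>.
\<close>

abbreviation fgen :: "'x \<Rightarrow> ('x \<Rightarrow>\<^sub>0 'k::comm_ring_1)"
  where "fgen x \<equiv> Poly_Mapping.single x 1"

definition fscale :: "'k::comm_ring_1 \<Rightarrow> ('x \<Rightarrow>\<^sub>0 'k) \<Rightarrow> ('x \<Rightarrow>\<^sub>0 'k)"
  where "fscale r = Poly_Mapping.map ((*) r)"

lemma lookup_fscale: "Poly_Mapping.lookup (fscale r x) p = r * Poly_Mapping.lookup x p"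
  by (simp add: fscale_def Poly_Mapping.map.rep_eq when_def)

interpretation free: module "fscale :: 'k::comm_ring_1 \<Rightarrow> ('x \<Rightarrow>\<^sub>0 'k) \<Rightarrow> _"
  by unfold_locales
    (auto intro!: poly_mapping_eqI simp: lookup_fscale lookup_add algebra_simps)

text \<open>
  The linear extension of \<open>f\<close>, given on basis vectors, to the free module; \<open>s\<close> is the scalar
  multiplication of the codomain.
\<close>

definition lin_ext :: "('k::comm_ring_1 \<Rightarrow> 'v \<Rightarrow> 'v) \<Rightarrow> ('x \<Rightarrow> 'v) \<Rightarrow> ('x \<Rightarrow>\<^sub>0 'k) \<Rightarrow> 'v::ab_group_add"
  where "lin_ext s f x = (\<Sum>p\<in>Poly_Mapping.keys x. s (Poly_Mapping.lookup x p) (f p))"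

text \<open>
  Elements of a quotient by a submodule \<open>N\<close> are cosets. Maps out of a quotient are defined by
  evaluating at the chosen representative \<open>rep X\<close>; each such map below is independent of this
  choice, because it comes from a map that respects the relations.
\<close>

definition cls :: "'v::ab_group_add set \<Rightarrow> 'v \<Rightarrow> 'v set"
  where "cls N x = (\<lambda>n. x + n) ` N"

definition rep :: "'v set \<Rightarrow> 'v"
  where "rep X = (SOME x. x \<in> X)"

definition quot_add :: "'v::ab_group_add set \<Rightarrow> 'v set \<Rightarrow> 'v set \<Rightarrow> 'v set"
  where "quot_add N X Y = cls N (rep X + rep Y)"

definition quot_scale ::
    "('x \<Rightarrow>\<^sub>0 'k::comm_ring_1) set \<Rightarrow> 'k \<Rightarrow> ('x \<Rightarrow>\<^sub>0 'k) set \<Rightarrow> ('x \<Rightarrow>\<^sub>0 'k) set"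
  where "quot_scale N r X = cls N (fscale r (rep X))"


section \<open>Tensor products\<close>

definition bilinear_rels ::
    "('k::comm_ring_1 \<Rightarrow> 'a \<Rightarrow> 'a::ab_group_add) \<Rightarrow> ('k \<Rightarrow> 'b \<Rightarrow> 'b::ab_group_add) \<Rightarrow>
      ('a \<times> 'b \<Rightarrow>\<^sub>0 'k) set"
  where "bilinear_rels s t =
      {fgen (a + a', b) - fgen (a, b) - fgen (a', b) |a a' b. True} \<union>
      {fgen (a, b + b') - fgen (a, b) - fgen (a, b') |a b b'. True} \<union>
      {fgen (s r a, b) - fscale r (fgen (a, b)) |r a b. True} \<union>
      {fgen (a, t r b) - fscale r (fgen (a, b)) |r a b. True}"

definition tensor_null ::
    "('k::comm_ring_1 \<Rightarrow> 'a \<Rightarrow> 'a::ab_group_add) \<Rightarrow> ('k \<Rightarrow> 'b \<Rightarrow> 'b::ab_group_add) \<Rightarrow>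
      ('a \<times> 'b \<Rightarrow>\<^sub>0 'k) set"
  where "tensor_null s t = free.span (bilinear_rels s t)"

definition tensor ::
    "('k::comm_ring_1 \<Rightarrow> 'a \<Rightarrow> 'a::ab_group_add) \<Rightarrow> ('k \<Rightarrow> 'b \<Rightarrow> 'b::ab_group_add) \<Rightarrow>
      ('a \<times> 'b \<Rightarrow>\<^sub>0 'k) set set"
  where "tensor s t = range (cls (tensor_null s t))"

definition pure ::
    "('k::comm_ring_1 \<Rightarrow> 'a \<Rightarrow> 'a::ab_group_add) \<Rightarrow> ('k \<Rightarrow> 'b \<Rightarrow> 'b::ab_group_add) \<Rightarrow>
      'a \<Rightarrow> 'b \<Rightarrow> ('a \<times> 'b \<Rightarrow>\<^sub>0 'k) set"
  where "pure s t a b = cls (tensor_null s t) (fgen (a, b))"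

text \<open>
  The product \<open>(a \<otimes> b) (a' \<otimes> b') = a a' \<otimes> b b'\<close> of the tensor product of two algebras.
\<close>

definition tensor_mult ::
    "('k::comm_ring_1 \<Rightarrow> 'a \<Rightarrow> 'a::ring) \<Rightarrow> ('k \<Rightarrow> 'b \<Rightarrow> 'b::ring) \<Rightarrow>
      ('a \<times> 'b \<Rightarrow>\<^sub>0 'k) set \<Rightarrow> ('a \<times> 'b \<Rightarrow>\<^sub>0 'k) set \<Rightarrow> ('a \<times> 'b \<Rightarrow>\<^sub>0 'k) set"
  where "tensor_mult s t X Y = cls (tensor_null s t)
      (lin_ext fscale (\<lambda>(a, b). lin_ext fscale (\<lambda>(a', b'). fgen (a * a', b * b')) (rep Y)) (rep X))"

text \<open>The threefold tensor product over the base ring.\<close>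

definition trilinear_rels ::
    "('k::comm_ring_1 \<Rightarrow> 'a \<Rightarrow> 'a::ab_group_add) \<Rightarrow> ('k \<Rightarrow> 'b \<Rightarrow> 'b::ab_group_add) \<Rightarrow>
      ('k \<Rightarrow> 'c \<Rightarrow> 'c::ab_group_add) \<Rightarrow> ('a \<times> 'b \<times> 'c \<Rightarrow>\<^sub>0 'k) set"
  where "trilinear_rels s t u =
      {fgen (a + a', b, c) - fgen (a, b, c) - fgen (a', b, c) |a a' b c. True} \<union>
      {fgen (a, b + b', c) - fgen (a, b, c) - fgen (a, b', c) |a b b' c. True} \<union>
      {fgen (a, b, c + c') - fgen (a, b, c) - fgen (a, b, c') |a b c c'. True} \<union>
      {fgen (s r a, b, c) - fscale r (fgen (a, b, c)) |r a b c. True} \<union>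
      {fgen (a, t r b, c) - fscale r (fgen (a, b, c)) |r a b c. True} \<union>
      {fgen (a, b, u r c) - fscale r (fgen (a, b, c)) |r a b c. True}"

definition tensor3_null ::
    "('k::comm_ring_1 \<Rightarrow> 'a \<Rightarrow> 'a::ab_group_add) \<Rightarrow> ('k \<Rightarrow> 'b \<Rightarrow> 'b::ab_group_add) \<Rightarrow>
      ('k \<Rightarrow> 'c \<Rightarrow> 'c::ab_group_add) \<Rightarrow> ('a \<times> 'b \<times> 'c \<Rightarrow>\<^sub>0 'k) set"
  where "tensor3_null s t u = free.span (trilinear_rels s t u)"

text \<open>
  For a subalgebra \<open>B\<close> of an algebra \<open>A\<close>, the module \<open>A \<otimes>\<^bsub>B\<^esub> A\<close> is the quotient of \<open>A \<otimes> A\<close>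
  by the elements \<open>a b \<otimes> a' - a \<otimes> b a'\<close> with \<open>b \<in> B\<close>.
\<close>

definition balanced_null ::
    "('k::comm_ring_1 \<Rightarrow> 'a \<Rightarrow> 'a::ring) \<Rightarrow> 'a set \<Rightarrow> ('a \<times> 'a \<Rightarrow>\<^sub>0 'k) set"
  where "balanced_null s B = free.span
      (bilinear_rels s s \<union> {fgen (a * b, a') - fgen (a, b * a') |a b a'. b \<in> B})"

definition balanced_tensor ::
    "('k::comm_ring_1 \<Rightarrow> 'a \<Rightarrow> 'a::ring) \<Rightarrow> 'a set \<Rightarrow> ('a \<times> 'a \<Rightarrow>\<^sub>0 'k) set set"
  where "balanced_tensor s B = range (cls (balanced_null s B))"

text \<open>
  Maps out of a tensor product, \<open>tensor_lift s f\<close> sending \<open>a \<otimes> b\<close> to \<open>f a b\<close> in the module with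
  scalar multiplication \<open>s\<close>, and \<open>quot_lift N f\<close> sending \<open>a \<otimes> b\<close> to the class of \<open>f a b\<close>
  modulo \<open>N\<close>.
\<close>

definition tensor_lift ::
    "('k::comm_ring_1 \<Rightarrow> 'v \<Rightarrow> 'v::ab_group_add) \<Rightarrow> ('a \<Rightarrow> 'b \<Rightarrow> 'v) \<Rightarrow> ('a \<times> 'b \<Rightarrow>\<^sub>0 'k) set \<Rightarrow> 'v"
  where "tensor_lift s f X = lin_ext s (\<lambda>(a, b). f a b) (rep X)"

definition quot_lift ::
    "('y \<Rightarrow>\<^sub>0 'k::comm_ring_1) set \<Rightarrow> ('a \<Rightarrow> 'b \<Rightarrow> ('y \<Rightarrow>\<^sub>0 'k)) \<Rightarrow> ('a \<times> 'b \<Rightarrow>\<^sub>0 'k) set \<Rightarrow>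
      ('y \<Rightarrow>\<^sub>0 'k) set"
  where "quot_lift N f X = cls N (tensor_lift fscale f X)"


section \<open>Algebras, Hopf algebras and comodule algebras\<close>

text \<open>
  The sort \<open>{ring, monoid_mult}\<close> is that of unital rings; unlike \<open>ring_1\<close> it allows the zero ring.
\<close>

locale k_algebra = module s
  for s :: "'k::comm_ring_1 \<Rightarrow> 'a \<Rightarrow> 'a::{ring, monoid_mult}" +
  assumes scale_mult_left: "s r x * y = s r (x * y)"
    and scale_mult_right: "x * s r y = s r (x * y)"

definition algebra_map ::
    "('k::comm_ring_1 \<Rightarrow> 'a \<Rightarrow> 'a::{ring, monoid_mult}) \<Rightarrow>
      ('k \<Rightarrow> 'b \<Rightarrow> 'b::{ring, monoid_mult}) \<Rightarrow> ('a \<Rightarrow> 'b) \<Rightarrow> bool"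
  where "algebra_map s t f \<longleftrightarrow>
      (\<forall>x y. f (x + y) = f x + f y) \<and> (\<forall>r x. f (s r x) = t r (f x)) \<and>
      (\<forall>x y. f (x * y) = f x * f y) \<and> f 1 = 1"

definition algebra_map_to_tensor ::
    "('k::comm_ring_1 \<Rightarrow> 'c \<Rightarrow> 'c::{ring, monoid_mult}) \<Rightarrow>
      ('k \<Rightarrow> 'a \<Rightarrow> 'a::{ring, monoid_mult}) \<Rightarrow> ('k \<Rightarrow> 'b \<Rightarrow> 'b::{ring, monoid_mult}) \<Rightarrow>
      ('c \<Rightarrow> ('a \<times> 'b \<Rightarrow>\<^sub>0 'k) set) \<Rightarrow> bool"
  where "algebra_map_to_tensor u s t f \<longleftrightarrow>
      (\<forall>x. f x \<in> tensor s t) \<and>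
      (\<forall>x y. f (x + y) = quot_add (tensor_null s t) (f x) (f y)) \<and>
      (\<forall>r x. f (u r x) = quot_scale (tensor_null s t) r (f x)) \<and>
      (\<forall>x y. f (x * y) = tensor_mult s t (f x) (f y)) \<and>
      f 1 = pure s t 1 1"

text \<open>
  For \<open>f : M \<rightarrow> M \<otimes> H\<close> and \<open>g : H \<rightarrow> H \<otimes> H\<close>, the maps
  \<open>f \<otimes> id, id \<otimes> g : M \<otimes> H \<rightarrow> M \<otimes> H \<otimes> H\<close>.
\<close>

definition map_left ::
    "('k::comm_ring_1 \<Rightarrow> 'm \<Rightarrow> 'm::ab_group_add) \<Rightarrow> ('k \<Rightarrow> 'h \<Rightarrow> 'h::ab_group_add) \<Rightarrow>
      ('m \<Rightarrow> ('m \<times> 'h \<Rightarrow>\<^sub>0 'k) set) \<Rightarrow> ('m \<times> 'h \<Rightarrow>\<^sub>0 'k) set \<Rightarrow> ('m \<times> 'h \<times> 'h \<Rightarrow>\<^sub>0 'k) set"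
  where "map_left sM sH f = quot_lift (tensor3_null sM sH sH)
      (\<lambda>m h. tensor_lift fscale (\<lambda>m' h'. fgen (m', h', h)) (f m))"

definition map_right ::
    "('k::comm_ring_1 \<Rightarrow> 'm \<Rightarrow> 'm::ab_group_add) \<Rightarrow> ('k \<Rightarrow> 'h \<Rightarrow> 'h::ab_group_add) \<Rightarrow>
      ('h \<Rightarrow> ('h \<times> 'h \<Rightarrow>\<^sub>0 'k) set) \<Rightarrow> ('m \<times> 'h \<Rightarrow>\<^sub>0 'k) set \<Rightarrow> ('m \<times> 'h \<times> 'h \<Rightarrow>\<^sub>0 'k) set"
  where "map_right sM sH g = quot_lift (tensor3_null sM sH sH)
      (\<lambda>m h. tensor_lift fscale (\<lambda>h' h''. fgen (m, h', h'')) (g h))"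

locale hopf_algebra = k_algebra sH
  for sH :: "'k::comm_ring_1 \<Rightarrow> 'h \<Rightarrow> 'h::{ring, monoid_mult}" +
  fixes \<Delta> :: "'h \<Rightarrow> ('h \<times> 'h \<Rightarrow>\<^sub>0 'k) set"
    and \<epsilon> :: "'h \<Rightarrow> 'k"
    and S :: "'h \<Rightarrow> 'h"
  assumes comult_algebra_map: "algebra_map_to_tensor sH sH sH \<Delta>"
    and counit_algebra_map: "algebra_map sH (*) \<epsilon>"
    and coassoc: "map_left sH sH \<Delta> (\<Delta> h) = map_right sH sH \<Delta> (\<Delta> h)"
    and counit_left: "tensor_lift sH (\<lambda>x y. sH (\<epsilon> x) y) (\<Delta> h) = h"
    and counit_right: "tensor_lift sH (\<lambda>x y. sH (\<epsilon> y) x) (\<Delta> h) = h"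
    and antipode_add: "S (x + y) = S x + S y"
    and antipode_scale: "S (sH r x) = sH r (S x)"
    and antipode_left: "tensor_lift sH (\<lambda>x y. S x * y) (\<Delta> h) = sH (\<epsilon> h) 1"
    and antipode_right: "tensor_lift sH (\<lambda>x y. x * S y) (\<Delta> h) = sH (\<epsilon> h) 1"

locale comodule_algebra = H: hopf_algebra sH \<Delta> \<epsilon> S + A: k_algebra sA
  for sH :: "'k::comm_ring_1 \<Rightarrow> 'h \<Rightarrow> 'h::{ring, monoid_mult}"
    and \<Delta> :: "'h \<Rightarrow> ('h \<times> 'h \<Rightarrow>\<^sub>0 'k) set"
    and \<epsilon> :: "'h \<Rightarrow> 'k"
    and S :: "'h \<Rightarrow> 'h"
    and sA :: "'k \<Rightarrow> 'a \<Rightarrow> 'a::{ring, monoid_mult}" +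
  fixes \<delta> :: "'a \<Rightarrow> ('a \<times> 'h \<Rightarrow>\<^sub>0 'k) set"
  assumes coaction_algebra_map: "algebra_map_to_tensor sA sA sH \<delta>"
    and coaction_coassoc: "map_left sA sH \<delta> (\<delta> a) = map_right sA sH \<Delta> (\<delta> a)"
    and coaction_counit: "tensor_lift sA (\<lambda>x h. sA (\<epsilon> h) x) (\<delta> a) = a"

definition coinvariants ::
    "('k::comm_ring_1 \<Rightarrow> 'a \<Rightarrow> 'a::{ring, monoid_mult}) \<Rightarrow>
      ('k \<Rightarrow> 'h \<Rightarrow> 'h::{ring, monoid_mult}) \<Rightarrow> ('a \<Rightarrow> ('a \<times> 'h \<Rightarrow>\<^sub>0 'k) set) \<Rightarrow> 'a set"
  where "coinvariants sA sH \<delta> = {b. \<delta> b = pure sA sH b 1}"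

text \<open>\<open>comodule_map sA sH \<delta> \<Phi>\<close> states \<open>\<delta> \<circ> \<Phi> = (\<Phi> \<otimes> id) \<circ> \<delta>\<close>; linearity is stated separately.\<close>

definition comodule_map ::
    "('k::comm_ring_1 \<Rightarrow> 'a \<Rightarrow> 'a::{ring, monoid_mult}) \<Rightarrow>
      ('k \<Rightarrow> 'h \<Rightarrow> 'h::{ring, monoid_mult}) \<Rightarrow> ('a \<Rightarrow> ('a \<times> 'h \<Rightarrow>\<^sub>0 'k) set) \<Rightarrow> ('a \<Rightarrow> 'a) \<Rightarrow> bool"
  where "comodule_map sA sH \<delta> \<Phi> \<longleftrightarrow>
      (\<forall>a. \<delta> (\<Phi> a) = quot_lift (tensor_null sA sH) (\<lambda>x h. fgen (\<Phi> x, h)) (\<delta> a))"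


section \<open>Hopf--Galois extensions and their gauge transformations\<close>

text \<open>The canonical map \<open>A \<otimes>\<^bsub>B\<^esub> A \<rightarrow> A \<otimes> H\<close>, \<open>a' \<otimes> a \<mapsto> a' a\<^bsub>(0)\<^esub> \<otimes> a\<^bsub>(1)\<^esub>\<close>.\<close>

definition canonical_map ::
    "('k::comm_ring_1 \<Rightarrow> 'a \<Rightarrow> 'a::{ring, monoid_mult}) \<Rightarrow>
      ('k \<Rightarrow> 'h \<Rightarrow> 'h::{ring, monoid_mult}) \<Rightarrow> ('a \<Rightarrow> ('a \<times> 'h \<Rightarrow>\<^sub>0 'k) set) \<Rightarrow>
      ('a \<times> 'a \<Rightarrow>\<^sub>0 'k) set \<Rightarrow> ('a \<times> 'h \<Rightarrow>\<^sub>0 'k) set"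
  where "canonical_map sA sH \<delta> = quot_lift (tensor_null sA sH)
      (\<lambda>a' a. tensor_lift fscale (\<lambda>x h. fgen (a' * x, h)) (\<delta> a))"

locale hopf_galois_extension = comodule_algebra sH \<Delta> \<epsilon> S sA \<delta>
  for sH :: "'k::comm_ring_1 \<Rightarrow> 'h \<Rightarrow> 'h::{ring, monoid_mult}"
    and \<Delta> :: "'h \<Rightarrow> ('h \<times> 'h \<Rightarrow>\<^sub>0 'k) set"
    and \<epsilon> :: "'h \<Rightarrow> 'k"
    and S :: "'h \<Rightarrow> 'h"
    and sA :: "'k \<Rightarrow> 'a \<Rightarrow> 'a::{ring, monoid_mult}"
    and \<delta> :: "'a \<Rightarrow> ('a \<times> 'h \<Rightarrow>\<^sub>0 'k) set" +
  assumes canonical_bij: "bij_betw (canonical_map sA sH \<delta>)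
      (balanced_tensor sA (coinvariants sA sH \<delta>)) (tensor sA sH)"

definition translation_map ::
    "('k::comm_ring_1 \<Rightarrow> 'a \<Rightarrow> 'a::{ring, monoid_mult}) \<Rightarrow>
      ('k \<Rightarrow> 'h \<Rightarrow> 'h::{ring, monoid_mult}) \<Rightarrow> ('a \<Rightarrow> ('a \<times> 'h \<Rightarrow>\<^sub>0 'k) set) \<Rightarrow>
      'h \<Rightarrow> ('a \<times> 'a \<Rightarrow>\<^sub>0 'k) set"
  where "translation_map sA sH \<delta> h =
      inv_into (balanced_tensor sA (coinvariants sA sH \<delta>)) (canonical_map sA sH \<delta>)
        (pure sA sH 1 h)"

definition Aut_B ::
    "('k::comm_ring_1 \<Rightarrow> 'a \<Rightarrow> 'a::{ring, monoid_mult}) \<Rightarrow>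
      ('k \<Rightarrow> 'h \<Rightarrow> 'h::{ring, monoid_mult}) \<Rightarrow> ('a \<Rightarrow> ('a \<times> 'h \<Rightarrow>\<^sub>0 'k) set) \<Rightarrow> ('a \<Rightarrow> 'a) set"
  where "Aut_B sA sH \<delta> =
      {\<Phi>. algebra_map sA sA \<Phi> \<and> comodule_map sA sH \<delta> \<Phi> \<and> (\<forall>b\<in>coinvariants sA sH \<delta>. \<Phi> b = b)}"

definition Aut_B_group ::
    "('k::comm_ring_1 \<Rightarrow> 'a \<Rightarrow> 'a::{ring, monoid_mult}) \<Rightarrow>
      ('k \<Rightarrow> 'h \<Rightarrow> 'h::{ring, monoid_mult}) \<Rightarrow> ('a \<Rightarrow> ('a \<times> 'h \<Rightarrow>\<^sub>0 'k) set) \<Rightarrow> ('a \<Rightarrow> 'a) monoid"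
  where "Aut_B_group sA sH \<delta> =
      \<lparr>carrier = Aut_B sA sH \<delta>, monoid.mult = (\<lambda>\<Phi> \<Psi>. \<Psi> \<circ> \<Phi>), one = id\<rparr>"

text \<open>
  The map \<open>a \<mapsto> a\<^bsub>(0)\<^esub> \<Phi> (a\<^bsub>(1)\<^esub>\<^sup><\<^sup>1\<^sup>>) a\<^bsub>(1)\<^esub>\<^sup><\<^sup>2\<^sup>>\<close>. The inner lift is the map
  \<open>a' \<otimes> a'' \<mapsto> \<Phi> a' a''\<close> on \<open>A \<otimes>\<^bsub>B\<^esub> A\<close>, which is well defined for \<open>\<Phi> \<in> Aut_B\<close>.
\<close>

definition gauge_inverse ::
    "('k::comm_ring_1 \<Rightarrow> 'a \<Rightarrow> 'a::{ring, monoid_mult}) \<Rightarrow>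
      ('k \<Rightarrow> 'h \<Rightarrow> 'h::{ring, monoid_mult}) \<Rightarrow> ('a \<Rightarrow> ('a \<times> 'h \<Rightarrow>\<^sub>0 'k) set) \<Rightarrow> ('a \<Rightarrow> 'a) \<Rightarrow> 'a \<Rightarrow> 'a"
  where "gauge_inverse sA sH \<delta> \<Phi> a =
      tensor_lift sA
        (\<lambda>a0 a1. a0 * tensor_lift sA (\<lambda>a' a''. \<Phi> a' * a'') (translation_map sA sH \<delta> a1))
        (\<delta> a)"


section \<open>Base rings\<close>

definition is_field :: "'k::comm_ring_1 itself \<Rightarrow> bool"
  where "is_field _ \<longleftrightarrow> (\<forall>x::'k. x \<noteq> 0 \<longrightarrow> (\<exists>y. x * y = 1))"

definition is_power_series_ring :: "'k::comm_ring_1 itself \<Rightarrow> 'f::field itself \<Rightarrow> bool"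
  where "is_power_series_ring _ _ \<longleftrightarrow>
      (\<exists>\<phi> :: 'k \<Rightarrow> 'f fps. bij \<phi> \<and> (\<forall>x y. \<phi> (x + y) = \<phi> x + \<phi> y) \<and>
        (\<forall>x y. \<phi> (x * y) = \<phi> x * \<phi> y) \<and> \<phi> 1 = 1)"

end

theory Submission
  imports Defs
begin

text \<open>
  Composites of gauge transformations are gauge transformations, so the content is that every
  \<open>\<Phi> \<in> Aut_B\<close> is invertible, with inverse \<open>\<Psi> a = a\<^bsub>(0)\<^esub> \<Phi> (a\<^bsub>(1)\<^esub>\<^sup><\<^sup>1\<^sup>>) a\<^bsub>(1)\<^esub>\<^sup><\<^sup>2\<^sup>>\<close>. Both composites of \<open>\<Phi>\<close>
  and \<open>\<Psi>\<close> equal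
  \<open>T a = \<Phi> (a\<^bsub>(0)\<^esub>) \<Phi> (a\<^bsub>(1)\<^esub>\<^sup><\<^sup>1\<^sup>>) a\<^bsub>(1)\<^esub>\<^sup><\<^sup>2\<^sup>>\<close>, and \<open>T\<close> is the identity. The injectivity of the canonical
  map \<open>\<chi>\<close> gives three things.

  \<^item> \<open>a\<^bsub>(0)\<^esub> a\<^bsub>(1)\<^esub>\<^sup><\<^sup>1\<^sup>> \<otimes> a\<^bsub>(1)\<^esub>\<^sup><\<^sup>2\<^sup>> = 1 \<otimes> a\<close> in \<open>A \<otimes>\<^bsub>B\<^esub> A\<close>, since \<open>\<chi>\<close> is left \<open>A\<close>-linear and sends both
    sides to \<open>a\<^bsub>(0)\<^esub> \<otimes> a\<^bsub>(1)\<^esub>\<close> (\<open>coaction_translation\<close>). The map \<open>a' \<otimes> a'' \<mapsto> \<Phi> a' a''\<close> turns this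
    into \<open>T a = a\<close>.
  \<^item> \<open>(\<Phi> \<otimes> \<Phi>) (\<tau> h) = \<tau> h\<close>, since \<open>\<chi> \<circ> (\<Phi> \<otimes> \<Phi>) = (\<Phi> \<otimes> id) \<circ> \<chi>\<close> and \<open>\<Phi> \<otimes> id\<close> fixes \<open>1 \<otimes> h\<close>
    (\<open>gauge_both_translation\<close>). So \<open>\<Phi>\<close> fixes \<open>\<Phi> (h\<^sup><\<^sup>1\<^sup>>) h\<^sup><\<^sup>2\<^sup>>\<close>, and multiplicativity of \<open>\<Phi>\<close> gives
    \<open>\<Phi> (\<Psi> a) = T a\<close>.
  \<^item> \<open>\<tau>\<close> is linear, so \<open>x \<otimes> h \<mapsto> x \<Phi> (h\<^sup><\<^sup>1\<^sup>>) h\<^sup><\<^sup>2\<^sup>>\<close> is well defined on \<open>A \<otimes> H\<close>. Evaluated at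
    \<open>\<delta> (\<Phi> a) = \<Phi> (a\<^bsub>(0)\<^esub>) \<otimes> a\<^bsub>(1)\<^esub>\<close> it gives \<open>\<Psi> (\<Phi> a) = T a\<close>.

  As the inverse of a bijective morphism of comodule algebras, \<open>\<Psi>\<close> is such a morphism itself.

  Tensor products are quotients of free modules. All computations take place on representatives:
  an equality in a quotient becomes membership of the difference in the submodule of relations,
  and a linear map on a free module is determined by its values on basis vectors.
\<close>

section \<open>Linear maps on free modules\<close>

lemma module_hom_lin_ext:
  fixes s :: "'k::comm_ring_1 \<Rightarrow> 'v \<Rightarrow> 'v::ab_group_add" and f :: "'x \<Rightarrow> 'v"
  assumes "module s"
  shows "module_hom fscale s (lin_ext s f)"
proof -
  interpret module s by fact
  have superset: "lin_ext s f x = (\<Sum>p\<in>I. s (Poly_Mapping.lookup x p) (f p))"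
    if "finite I" "Poly_Mapping.keys x \<subseteq> I" for x I
    unfolding lin_ext_def using that
    by (intro sum.mono_neutral_left) (auto simp: in_keys_iff)
  show ?thesis
  proof
    fix x y :: "'x \<Rightarrow>\<^sub>0 'k"
    let ?I = "Poly_Mapping.keys x \<union> Poly_Mapping.keys y"
    have "Poly_Mapping.keys (x + y) \<subseteq> ?I"
      by (rule Poly_Mapping.keys_add)
    then show "lin_ext s f (x + y) = lin_ext s f x + lin_ext s f y"
      by (simp add: superset[of ?I] lookup_add scale_left_distrib sum.distrib)
  next
    fix r and x :: "'x \<Rightarrow>\<^sub>0 'k"
    have "Poly_Mapping.keys (fscale r x) \<subseteq> Poly_Mapping.keys x"
      by (auto simp: in_keys_iff lookup_fscale)
    then show "lin_ext s f (fscale r x) = s r (lin_ext s f x)"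
      by (simp add: superset[of "Poly_Mapping.keys x"] lookup_fscale scale_sum_right)
  qed
qed

lemma lin_ext_fgen:
  assumes "module s"
  shows "lin_ext s f (fgen p) = f p"
proof -
  interpret module s by fact
  show ?thesis by (simp add: lin_ext_def)
qed

lemma lin_ext_fscale_fgen [simp]: "lin_ext fscale f (fgen p) = f p"
  by (rule lin_ext_fgen) (rule free.module_axioms)

lemma lin_ext_fgen_id: "lin_ext fscale fgen x = x"
proof (rule poly_mapping_eqI)
  fix k
  show "Poly_Mapping.lookup (lin_ext fscale fgen x) k = Poly_Mapping.lookup x k"
    unfolding lin_ext_def
    by (cases "k \<in> Poly_Mapping.keys x")
      (auto simp: Poly_Mapping.lookup_sum lookup_fscale lookup_single when_def if_distrib
        in_keys_iff cong: if_cong)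
qed

text \<open>
  Evaluating \<open>g\<close> on the expansion of \<open>x\<close> in basis vectors turns statements about all vectors
  into statements about basis vectors.
\<close>

lemma hom_mem_of_fgen:
  assumes "module_hom fscale s g" and "module.subspace s W" and "\<And>p. g (fgen p) \<in> W"
  shows "g x \<in> W"
proof -
  interpret module_hom fscale s g by fact
  have "g x = (\<Sum>p\<in>Poly_Mapping.keys x. s (Poly_Mapping.lookup x p) (g (fgen p)))"
    by (subst lin_ext_fgen_id[of x, symmetric]) (simp add: lin_ext_def sum scale)
  also have "\<dots> \<in> W"
    using assms(2,3) by (intro m2.subspace_sum m2.subspace_scale) auto
  finally show ?thesis .
qed

lemma hom_cong_modulo:
  assumes "module_hom fscale s g" and "module_hom fscale s g'" and "module.subspace s W"
    and "\<And>p. g (fgen p) - g' (fgen p) \<in> W"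
  shows "g x - g' x \<in> W"
proof -
  interpret module_hom fscale s g by fact
  interpret module_pair fscale s ..
  have "module_hom fscale s (\<lambda>x. g x - g' x)"
    using assms(1,2) by (rule module_hom_sub)
  from hom_mem_of_fgen[OF this assms(3,4)] show ?thesis .
qed

lemma hom_eqI:
  assumes "module_hom fscale s g" and "module_hom fscale s g'"
    and "\<And>p. g (fgen p) = g' (fgen p)"
  shows "g x = g' x"
proof -
  interpret module_hom fscale s g by fact
  have "g x - g' x \<in> {0}"
    using hom_cong_modulo[OF assms(1,2) m2.subspace_single_0] assms(3) by simp
  then show ?thesis by simp
qed

lemma hom_mem_of_span:
  assumes "module_hom fscale s g" and "module.subspace s W"
    and "\<And>p. p \<in> R \<Longrightarrow> g p \<in> W" and "x \<in> free.span R"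
  shows "g x \<in> W"
proof -
  interpret module_hom fscale s g by fact
  have "free.span R \<subseteq> {x. g x \<in> W}"
    using assms(2,3) by (intro free.span_minimal subspace_linear_preimage) auto
  then show ?thesis using assms(4) by auto
qed

lemma cls_eq_iff:
  assumes "free.subspace N"
  shows "cls N x = cls N y \<longleftrightarrow> x - y \<in> N"
proof
  assume "cls N x = cls N y"
  moreover have "x \<in> cls N x"
    using free.subspace_0[OF assms] by (auto simp: cls_def image_iff intro!: bexI[of _ 0])
  ultimately have "x \<in> cls N y" by simp
  then show "x - y \<in> N" by (auto simp: cls_def)
next
  assume d: "x - y \<in> N"
  have "x + n \<in> cls N y" if "n \<in> N" for n
    using free.subspace_add[OF assms d that]
    by (auto simp: cls_def image_iff algebra_simps intro!: bexI[of _ "x - y + n"])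
  moreover have "y + n \<in> cls N x" if "n \<in> N" for n
    using free.subspace_diff[OF assms that d]
    by (auto simp: cls_def image_iff algebra_simps intro!: bexI[of _ "n - (x - y)"])
  ultimately show "cls N x = cls N y" by (auto simp: cls_def)
qed

lemma rep_cls:
  assumes "free.subspace N"
  shows "rep (cls N x) - x \<in> N"
proof -
  have "x \<in> cls N x"
    using free.subspace_0[OF assms] by (auto simp: cls_def image_iff intro!: bexI[of _ 0])
  then have "rep (cls N x) \<in> cls N x"
    unfolding rep_def by (rule someI)
  then show ?thesis by (auto simp: cls_def)
qed

lemma cls_rep:
  assumes "free.subspace N" and "X \<in> range (cls N)"
  shows "cls N (rep X) = X"
proof -
  obtain x where "X = cls N x" using assms(2) by blast
  then show ?thesis using assms(1) by (simp add: cls_eq_iff rep_cls)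
qed

lemma modulo_trans:
  assumes "free.subspace N" and "x - y \<in> N" and "y - z \<in> N"
  shows "x - z \<in> N"
  using free.subspace_add[OF assms] by simp

lemma modulo_sym:
  assumes "free.subspace N" and "x - y \<in> N"
  shows "y - x \<in> N"
  using free.subspace_neg[OF assms] by simp

section \<open>Linear maps on tensor products\<close>

lemma subspace_tensor_null [simp]: "free.subspace (tensor_null s t)"
  by (simp add: tensor_null_def)

lemma subspace_balanced_null [simp]: "free.subspace (balanced_null s B)"
  by (simp add: balanced_null_def)

text \<open>
  Bilinearity modulo a submodule \<open>W\<close>. The congruence is needed because maps into a tensor
  product are handled through representatives, which are additive only up to relations.
\<close>

definition bilinear_modulo ::
    "('k::comm_ring_1 \<Rightarrow> 'a \<Rightarrow> 'a::ab_group_add) \<Rightarrow> ('k \<Rightarrow> 'b \<Rightarrow> 'b::ab_group_add) \<Rightarrow>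
      ('k \<Rightarrow> 'v \<Rightarrow> 'v::ab_group_add) \<Rightarrow> 'v set \<Rightarrow> ('a \<Rightarrow> 'b \<Rightarrow> 'v) \<Rightarrow> bool"
  where "bilinear_modulo s t u W f \<longleftrightarrow>
      (\<forall>a a' b. f (a + a') b - (f a b + f a' b) \<in> W) \<and>
      (\<forall>a b b'. f a (b + b') - (f a b + f a b') \<in> W) \<and>
      (\<forall>r a b. f (s r a) b - u r (f a b) \<in> W) \<and>
      (\<forall>r a b. f a (t r b) - u r (f a b) \<in> W)"

lemma lin_ext_bilinear_rels:
  assumes u: "module u" and f: "bilinear_modulo s t u W f" and x: "x \<in> bilinear_rels s t"
  shows "lin_ext u (\<lambda>(a, b). f a b) x \<in> W"
proof -
  interpret module_hom fscale u "lin_ext u (\<lambda>(a, b). f a b)"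
    using u by (rule module_hom_lin_ext)
  show ?thesis
    using f x unfolding bilinear_modulo_def bilinear_rels_def
    by (auto simp: add diff scale lin_ext_fgen[OF u] diff_diff_eq)
qed

lemma lin_ext_tensor_null:
  assumes u: "module u" and "module.subspace u W" and "bilinear_modulo s t u W f"
    and "x \<in> tensor_null s t"
  shows "lin_ext u (\<lambda>(a, b). f a b) x \<in> W"
  using assms(4) unfolding tensor_null_def
proof (rule hom_mem_of_span[OF module_hom_lin_ext[OF u] assms(2), rotated])
  show "lin_ext u (\<lambda>(a, b). f a b) p \<in> W" if "p \<in> bilinear_rels s t" for p
    using u assms(3) that by (rule lin_ext_bilinear_rels)
qed

lemma lin_ext_balanced_null:
  assumes u: "module u" and "module.subspace u W" and "bilinear_modulo s s u W f"
    and balanced: "\<And>a b a'. b \<in> B \<Longrightarrow> f (a * b) a' - f a (b * a') \<in> W"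
    and x: "x \<in> balanced_null s B"
  shows "lin_ext u (\<lambda>(a, b). f a b) x \<in> W"
  using x unfolding balanced_null_def
proof (rule hom_mem_of_span[OF module_hom_lin_ext[OF u] assms(2), rotated])
  interpret module_hom fscale u "lin_ext u (\<lambda>(a, b). f a b)"
    using u by (rule module_hom_lin_ext)
  fix p assume "p \<in> bilinear_rels s s \<union> {fgen (a * b, a') - fgen (a, b * a') |a b a'. b \<in> B}"
  then show "lin_ext u (\<lambda>(a, b). f a b) p \<in> W"
    using assms(3) balanced
    by (auto intro: lin_ext_bilinear_rels[OF u] simp: diff lin_ext_fgen[OF u])
qed

lemma bilinear_modulo_fgen: "bilinear_modulo s t fscale (tensor_null s t) (\<lambda>a b. fgen (a, b))"
proof -
  have "x \<in> tensor_null s t" if "x \<in> bilinear_rels s t" for x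
    using that by (simp add: tensor_null_def free.span_base)
  then show ?thesis
    unfolding bilinear_modulo_def bilinear_rels_def diff_diff_eq by fast
qed

lemmas module_hom_fscale = module_hom_lin_ext[OF free.module_axioms]

text \<open>
  The map \<open>g \<otimes> id\<close> on representatives. Left multiplication \<open>x \<otimes> h \<mapsto> a x \<otimes> h\<close> is the case
  \<open>g = (*) a\<close>.
\<close>

definition tensor_left :: "('a \<Rightarrow> 'b) \<Rightarrow> ('a \<times> 'c \<Rightarrow>\<^sub>0 'k) \<Rightarrow> ('b \<times> 'c \<Rightarrow>\<^sub>0 'k::comm_ring_1)"
  where "tensor_left g = lin_ext fscale (\<lambda>(x, h). fgen (g x, h))"

lemma tensor_left_fgen [simp]: "tensor_left g (fgen (x, h)) = fgen (g x, h)"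
  by (simp add: tensor_left_def)

lemma module_hom_tensor_left: "module_hom fscale fscale (tensor_left g)"
  unfolding tensor_left_def by (rule module_hom_fscale)

lemmas tensor_left_diff = module_hom.diff[OF module_hom_tensor_left]

lemma tensor_left_tensor_left: "tensor_left g (tensor_left g' x) = tensor_left (g \<circ> g') x"
  by (rule hom_eqI[OF module_hom_compose[OF module_hom_tensor_left module_hom_tensor_left,
        unfolded o_def] module_hom_tensor_left]) auto

lemma tensor_left_ident: "tensor_left (\<lambda>x. x) w = w"
  by (rule hom_eqI[OF module_hom_tensor_left free.module_hom_ident]) auto

lemma tensor_left_one [simp]: "tensor_left ((*) (1::'a::monoid_mult)) w = w"
proof -
  have "(*) (1::'a) = (\<lambda>x. x)" by auto
  then show ?thesis by (simp add: tensor_left_ident)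
qed

lemma tensor_left_mult_mult:
  "tensor_left ((*) a) (tensor_left ((*) b) w) = tensor_left ((*) (a * b :: 'a::semigroup_mult)) w"
proof -
  have "(*) a \<circ> (*) b = (*) (a * b)"
    by (auto simp: mult.assoc)
  then show ?thesis by (simp add: tensor_left_tensor_left)
qed

lemma tensor_left_mem_null:
  assumes "\<And>x y. g (x + y) = g x + g y" and "\<And>r x. g (s r x) = s' r (g x)"
    and "x \<in> tensor_null s t"
  shows "tensor_left g x \<in> tensor_null s' t"
proof -
  have "bilinear_modulo s t fscale (tensor_null s' t) (\<lambda>a b. fgen (g a, b))"
    using bilinear_modulo_fgen[of s' t] by (simp add: bilinear_modulo_def assms(1,2))
  from lin_ext_tensor_null[OF free.module_axioms _ this assms(3)]
  show ?thesis by (simp add: tensor_left_def)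
qed

text \<open>
  The argument \<open>w\<close> enters linearly, so bilinearity in the other two arguments has to be checked
  only when \<open>w\<close> is a basis vector.
\<close>

lemma bilinear_modulo_hom:
  assumes u: "module.subspace u W" and g: "\<And>a b. module_hom fscale u (g a b)"
    and bil: "\<And>p. bilinear_modulo s t u W (\<lambda>a b. g a b (fgen p))"
  shows "bilinear_modulo s t u W (\<lambda>a b. g a b w)"
proof -
  interpret module_hom fscale u "g a b" for a b by (rule g)
  interpret module_pair fscale u ..
  have add: "g a b w - (g a' b' w + g a'' b'' w) \<in> W"
    if "\<And>p. g a b (fgen p) - (g a' b' (fgen p) + g a'' b'' (fgen p)) \<in> W" for a b a' b' a'' b''
    using hom_cong_modulo[OF g module_hom_add[OF g g] u that] .
  have scale: "g a b w - u r (g a' b' w) \<in> W"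
    if "\<And>p. g a b (fgen p) - u r (g a' b' (fgen p)) \<in> W" for a b r a' b'
    using hom_cong_modulo[OF g module_hom_scale[OF g] u that] .
  show ?thesis
    using bil unfolding bilinear_modulo_def by (auto intro!: add scale)
qed

lemma bilinear_modulo_tensor_mult:
  assumes "k_algebra s" and "k_algebra t"
  shows "bilinear_modulo s t fscale (tensor_null s t)
    (\<lambda>a b. lin_ext fscale (\<lambda>(a', b'). fgen (a * a', b * b')) w)"
proof (rule bilinear_modulo_hom[OF subspace_tensor_null module_hom_fscale])
  interpret s: k_algebra s by fact
  interpret t: k_algebra t by fact
  fix p :: "'b \<times> 'c"
  show "bilinear_modulo s t fscale (tensor_null s t)
    (\<lambda>a b. lin_ext fscale (\<lambda>(a', b'). fgen (a * a', b * b')) (fgen p))"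
    using bilinear_modulo_fgen[of s t]
    by (cases p)
      (auto simp: bilinear_modulo_def s.scale_mult_left t.scale_mult_left distrib_right)
qed

section \<open>The canonical map on representatives\<close>

context comodule_algebra
begin

text \<open>The modules of relations \<open>K\<close> and \<open>J\<close> define \<open>A \<otimes> H\<close> and \<open>A \<otimes>\<^bsub>B\<^esub> A\<close>.\<close>

abbreviation "B \<equiv> coinvariants sA sH \<delta>"
abbreviation "K \<equiv> tensor_null sA sH"
abbreviation "J \<equiv> balanced_null sA B"

text \<open>A chosen representative of \<open>a\<^bsub>(0)\<^esub> \<otimes> a\<^bsub>(1)\<^esub>\<close>.\<close>

abbreviation "d a \<equiv> rep (\<delta> a)"

definition can :: "('a \<times> 'a \<Rightarrow>\<^sub>0 'k) \<Rightarrow> ('a \<times> 'h \<Rightarrow>\<^sub>0 'k)"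
  where "can = lin_ext fscale (\<lambda>(a', a). tensor_left ((*) a') (d a))"

lemma module_hom_can: "module_hom fscale fscale can"
  unfolding can_def by (rule module_hom_fscale)

lemmas can_diff = module_hom.diff[OF module_hom_can]

lemma can_fgen [simp]: "can (fgen (a', a)) = tensor_left ((*) a') (d a)"
  by (simp add: can_def)

lemma cls_rep_coaction: "cls K (d a) = \<delta> a"
  using coaction_algebra_map
  by (intro cls_rep) (auto simp: algebra_map_to_tensor_def tensor_def)

lemma coaction_rep_add: "d (a + a') - (d a + d a') \<in> K"
  and coaction_rep_scale: "d (sA r a) - fscale r (d a) \<in> K"
proof -
  have "\<delta> (a + a') = cls K (d a + d a')" "\<delta> (sA r a) = cls K (fscale r (d a))"
    using coaction_algebra_map
    by (auto simp: algebra_map_to_tensor_def quot_add_def quot_scale_def)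
  then show "d (a + a') - (d a + d a') \<in> K" "d (sA r a) - fscale r (d a) \<in> K"
    by (simp_all add: rep_cls)
qed

text \<open>The coaction is multiplicative and \<open>\<delta> b = b \<otimes> 1\<close>, hence \<open>\<delta> (b a) = b a\<^bsub>(0)\<^esub> \<otimes> a\<^bsub>(1)\<^esub>\<close>.\<close>

lemma coaction_rep_coinvariant_mult:
  assumes "b \<in> B"
  shows "d (b * a) - tensor_left ((*) b) (d a) \<in> K"
proof -
  let ?mult = "lin_ext fscale (\<lambda>(x, h). lin_ext fscale (\<lambda>(x', h'). fgen (x * x', h * h')) (d a))"
  interpret module_hom fscale fscale ?mult
    by (rule module_hom_fscale)
  have "\<delta> (b * a) = tensor_mult sA sH (pure sA sH b 1) (\<delta> a)"
    using coaction_algebra_map assms by (simp add: algebra_map_to_tensor_def coinvariants_def)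
  also have "\<dots> = cls K (?mult (rep (cls K (fgen (b, 1)))))"
    by (simp add: tensor_mult_def pure_def)
  also have "\<dots> = cls K (?mult (fgen (b, 1)))"
    unfolding cls_eq_iff[OF subspace_tensor_null] diff[symmetric]
    by (rule lin_ext_tensor_null[OF free.module_axioms subspace_tensor_null
          bilinear_modulo_tensor_mult[OF A.k_algebra_axioms H.k_algebra_axioms] rep_cls])
      (rule subspace_tensor_null)
  also have "?mult (fgen (b, 1)) = tensor_left ((*) b) (d a)"
    by (simp add: tensor_left_def)
  finally show ?thesis by (simp add: rep_cls)
qed

lemma tensor_left_mult_mem_null: "x \<in> K \<Longrightarrow> tensor_left ((*) a) x \<in> K"
  by (rule tensor_left_mem_null) (simp_all add: distrib_left A.scale_mult_right)

lemma tensor_left_mult_add: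
    "tensor_left ((*) (a + a')) w - (tensor_left ((*) a) w + tensor_left ((*) a') w) \<in> K"
  and tensor_left_mult_scale:
    "tensor_left ((*) (sA r a)) w - fscale r (tensor_left ((*) a) w) \<in> K"
proof -
  let ?m = "\<lambda>x h. lin_ext fscale (\<lambda>(x', h'). fgen (x * x', h * h')) w"
  \<comment> \<open>At \<open>h = 1\<close> the product with \<open>x \<otimes> h\<close> is left multiplication by \<open>x\<close>.\<close>
  have "?m (a + a') 1 - (?m a 1 + ?m a' 1) \<in> K" "?m (sA r a) 1 - fscale r (?m a 1) \<in> K"
    using bilinear_modulo_tensor_mult[OF A.k_algebra_axioms H.k_algebra_axioms, of w]
    unfolding bilinear_modulo_def by blast+
  then show "tensor_left ((*) (a + a')) w - (tensor_left ((*) a) w + tensor_left ((*) a') w) \<in> K"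
    "tensor_left ((*) (sA r a)) w - fscale r (tensor_left ((*) a) w) \<in> K"
    by (simp_all add: tensor_left_def)
qed

text \<open>
  The relation for \<open>b \<in> B\<close> holds because \<open>\<delta>\<close> is left \<open>B\<close>-linear:
  \<open>a b a'\<^bsub>(0)\<^esub> \<otimes> a'\<^bsub>(1)\<^esub>\<close> is the image of both \<open>a b \<otimes> a'\<close> and \<open>a \<otimes> b a'\<close>.
\<close>

lemma can_balanced_null:
  assumes "x \<in> J"
  shows "can x \<in> K"
  unfolding can_def
proof (rule lin_ext_balanced_null[OF free.module_axioms subspace_tensor_null _ _ assms])
  interpret L: module_hom fscale fscale "tensor_left ((*) a) :: ('a \<times> 'h \<Rightarrow>\<^sub>0 'k) \<Rightarrow> _" for a :: 'a
    by (rule module_hom_tensor_left)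
  show "bilinear_modulo sA sA fscale K (\<lambda>a' a. tensor_left ((*) a') (d a))"
    using tensor_left_mult_add tensor_left_mult_scale
      tensor_left_mult_mem_null[OF coaction_rep_add]
      tensor_left_mult_mem_null[OF coaction_rep_scale]
    by (simp add: bilinear_modulo_def L.add L.diff L.scale)
  fix a b a' assume "b \<in> B"
  from modulo_sym[OF _ tensor_left_mult_mem_null[OF coaction_rep_coinvariant_mult[OF this],
        of a a', unfolded L.diff]]
  show "tensor_left ((*) (a * b)) (d a') - tensor_left ((*) a) (d (b * a')) \<in> K"
    by (simp add: tensor_left_mult_mult)
qed

lemma canonical_map_cls: "canonical_map sA sH \<delta> (cls J x) = cls K (can x)"
proof -
  have "canonical_map sA sH \<delta> (cls J x) = cls K (can (rep (cls J x)))"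
    by (simp add: canonical_map_def quot_lift_def tensor_lift_def can_def tensor_left_def)
  also have "\<dots> = cls K (can x)"
    by (simp add: cls_eq_iff can_diff[symmetric] can_balanced_null rep_cls)
  finally show ?thesis .
qed

lemma can_tensor_left_mult: "can (tensor_left ((*) a) x) = tensor_left ((*) a) (can x)"
  by (rule hom_eqI[OF module_hom_compose[OF module_hom_tensor_left module_hom_can, unfolded o_def]
        module_hom_compose[OF module_hom_can module_hom_tensor_left, unfolded o_def]])
    (auto simp: tensor_left_mult_mult)

end

context hopf_galois_extension
begin

text \<open>Chosen representatives of \<open>h\<^sup><\<^sup>1\<^sup>> \<otimes>\<^bsub>B\<^esub> h\<^sup><\<^sup>2\<^sup>>\<close>.\<close>

abbreviation "t h \<equiv> rep (translation_map sA sH \<delta> h)"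

lemma can_inject:
  assumes "can x - can y \<in> K"
  shows "x - y \<in> J"
proof -
  have "canonical_map sA sH \<delta> (cls J x) = canonical_map sA sH \<delta> (cls J y)"
    using assms by (simp add: canonical_map_cls cls_eq_iff)
  then have "cls J x = cls J y"
    using canonical_bij by (auto simp: bij_betw_def balanced_tensor_def dest: inj_onD)
  then show ?thesis by (simp add: cls_eq_iff)
qed

lemma can_translation: "can (t h) - fgen (1, h) \<in> K"
proof -
  have p: "pure sA sH 1 h \<in> canonical_map sA sH \<delta> ` balanced_tensor sA B"
    using canonical_bij by (auto simp: bij_betw_def tensor_def pure_def)
  have "cls K (can (t h)) = canonical_map sA sH \<delta> (cls J (t h))"
    by (simp add: canonical_map_cls)
  also have "cls J (t h) = translation_map sA sH \<delta> h"
    using inv_into_into[OF p]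
    by (intro cls_rep) (simp_all add: translation_map_def balanced_tensor_def)
  also have "canonical_map sA sH \<delta> (translation_map sA sH \<delta> h) = cls K (fgen (1, h))"
    using f_inv_into_f[OF p] by (simp add: translation_map_def pure_def)
  finally show ?thesis by (simp add: cls_eq_iff)
qed

text \<open>The translation map is linear because its composite \<open>h \<mapsto> 1 \<otimes> h\<close> with the canonical map is.\<close>

lemma translation_rep_add: "t (h + h') - (t h + t h') \<in> J"
  and translation_rep_scale: "t (sH r h) - fscale r (t h) \<in> J"
proof -
  interpret module_hom fscale fscale can by (rule module_hom_can)
  note K = free.subspace_diff[OF subspace_tensor_null] free.subspace_add[OF subspace_tensor_null]
    free.subspace_scale[OF subspace_tensor_null]
  have f: "fgen (1, h + h') - (fgen (1, h) + fgen (1, h')) \<in> K"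
    "fgen (1, sH r h) - fscale r (fgen (1, h)) \<in> K"
    using bilinear_modulo_fgen[of sA sH] by (simp_all add: bilinear_modulo_def)
  have "can (t (h + h')) - (can (t h) + can (t h')) \<in> K"
    using K(1)[OF K(2)[OF f(1) can_translation[of "h + h'"]]
        K(2)[OF can_translation[of h] can_translation[of h']]]
    by (simp add: algebra_simps)
  then show "t (h + h') - (t h + t h') \<in> J"
    by (intro can_inject) (simp add: add)
  have "can (t (sH r h)) - fscale r (can (t h)) \<in> K"
    using K(1)[OF K(2)[OF f(2) can_translation[of "sH r h"]] K(3)[OF can_translation[of h], of r]]
    by (simp add: algebra_simps free.scale_right_diff_distrib)
  then show "t (sH r h) - fscale r (t h) \<in> J"
    by (intro can_inject) (simp add: scale)
qed

text \<open>
  The inverse of the canonical map is \<open>x \<otimes> h \<mapsto> x h\<^sup><\<^sup>1\<^sup>> \<otimes> h\<^sup><\<^sup>2\<^sup>>\<close>, because the canonical map is left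
  \<open>A\<close>-linear. At \<open>a\<^bsub>(0)\<^esub> \<otimes> a\<^bsub>(1)\<^esub>\<close>, the image of \<open>1 \<otimes> a\<close>, this reads
  \<open>a\<^bsub>(0)\<^esub> a\<^bsub>(1)\<^esub>\<^sup><\<^sup>1\<^sup>> \<otimes> a\<^bsub>(1)\<^esub>\<^sup><\<^sup>2\<^sup>> = 1 \<otimes> a\<close>.
\<close>

lemma coaction_translation:
  "lin_ext fscale (\<lambda>(x, h). tensor_left ((*) x) (t h)) (d a) - fgen (1, a) \<in> J"
proof (rule can_inject)
  let ?R = "lin_ext fscale (\<lambda>(x, h). tensor_left ((*) x) (t h))"
  have "can (?R w) - w \<in> K" for w
  proof (rule hom_cong_modulo[OF module_hom_compose[OF module_hom_fscale module_hom_can,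
          unfolded o_def] free.module_hom_ident subspace_tensor_null])
    fix p :: "'a \<times> 'h"
    obtain x h where p: "p = (x, h)" by fastforce
    show "can (?R (fgen p)) - fgen p \<in> K"
      using tensor_left_mult_mem_null[OF can_translation, of x h]
      by (simp add: p can_tensor_left_mult tensor_left_diff)
  qed
  then show "can (?R (d a)) - can (fgen (1, a)) \<in> K"
    by simp
qed

section \<open>Gauge transformations and their inverses\<close>

context
  fixes \<Phi> :: "'a \<Rightarrow> 'a"
  assumes \<Phi>: "\<Phi> \<in> Aut_B sA sH \<delta>"
begin

lemma gauge_add: "\<Phi> (x + y) = \<Phi> x + \<Phi> y"
  and gauge_scale: "\<Phi> (sA r x) = sA r (\<Phi> x)"
  and gauge_mult: "\<Phi> (x * y) = \<Phi> x * \<Phi> y"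
  and gauge_one: "\<Phi> 1 = 1"
  and gauge_coinvariant: "b \<in> B \<Longrightarrow> \<Phi> b = b"
  using \<Phi> by (auto simp: Aut_B_def algebra_map_def)

lemma module_hom_gauge: "module_hom sA sA \<Phi>"
  by unfold_locales (simp_all add: gauge_add gauge_scale)

lemma tensor_left_gauge_mem_null: "x \<in> K \<Longrightarrow> tensor_left \<Phi> x \<in> K"
  by (rule tensor_left_mem_null) (simp_all add: gauge_add gauge_scale)

lemma coaction_rep_gauge: "d (\<Phi> a) - tensor_left \<Phi> (d a) \<in> K"
proof -
  have "\<delta> (\<Phi> a) = cls K (tensor_left \<Phi> (d a))"
    using \<Phi> by (simp add: Aut_B_def comodule_map_def quot_lift_def tensor_lift_def tensor_left_def)
  then show ?thesis by (simp add: rep_cls)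
qed

text \<open>The inner map of \<open>gauge_inverse\<close>; its value at \<open>t h\<close> is \<open>\<Phi> (h\<^sup><\<^sup>1\<^sup>>) h\<^sup><\<^sup>2\<^sup>>\<close>.\<close>

definition mult_gauge :: "('a \<times> 'a \<Rightarrow>\<^sub>0 'k) \<Rightarrow> 'a"
  where "mult_gauge = lin_ext sA (\<lambda>(x, y). \<Phi> x * y)"

definition gauge_both :: "('a \<times> 'a \<Rightarrow>\<^sub>0 'k) \<Rightarrow> ('a \<times> 'a \<Rightarrow>\<^sub>0 'k)"
  where "gauge_both = lin_ext fscale (\<lambda>(x, y). fgen (\<Phi> x, \<Phi> y))"

lemma module_hom_mult_gauge: "module_hom fscale sA mult_gauge"
  unfolding mult_gauge_def by (rule module_hom_lin_ext[OF A.module_axioms])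

lemma module_hom_gauge_both: "module_hom fscale fscale gauge_both"
  unfolding gauge_both_def by (rule module_hom_fscale)

lemma mult_gauge_fgen: "mult_gauge (fgen (x, y)) = \<Phi> x * y"
  unfolding mult_gauge_def by (simp add: lin_ext_fgen[OF A.module_axioms])

text \<open>
  Since \<open>\<Phi> b = b\<close> for \<open>b \<in> B\<close>, the elements \<open>a b \<otimes> a'\<close> and \<open>a \<otimes> b a'\<close> have the same image
  \<open>\<Phi> a b a'\<close>, so the map descends to \<open>A \<otimes>\<^bsub>B\<^esub> A\<close>.
\<close>

lemma mult_gauge_cong:
  assumes "x - y \<in> J"
  shows "mult_gauge x = mult_gauge y"
proof -
  have "mult_gauge (x - y) \<in> {0}"
    unfolding mult_gauge_def
    by (rule lin_ext_balanced_null[OF A.module_axioms _ _ _ assms])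
      (auto simp: bilinear_modulo_def gauge_add gauge_scale gauge_mult gauge_coinvariant
        algebra_simps A.scale_mult_left A.scale_mult_right)
  then show ?thesis by (simp add: module_hom.diff[OF module_hom_mult_gauge])
qed

lemma mult_gauge_tensor_left: "mult_gauge (tensor_left ((*) a) u) = \<Phi> a * mult_gauge u"
proof (rule hom_eqI[OF module_hom_compose[OF module_hom_tensor_left module_hom_mult_gauge,
        unfolded o_def]])
  interpret module_hom fscale sA mult_gauge by (rule module_hom_mult_gauge)
  show "module_hom fscale sA (\<lambda>u. \<Phi> a * mult_gauge u)"
    by unfold_locales (simp_all add: add scale distrib_left A.scale_mult_right)
qed (auto simp: mult_gauge_fgen gauge_mult mult.assoc)

text \<open>
  The canonical map intertwines \<open>\<Phi> \<otimes> \<Phi>\<close> with \<open>\<Phi> \<otimes> id\<close>, and \<open>\<Phi> \<otimes> id\<close> fixes \<open>1 \<otimes> h\<close>.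
\<close>

lemma gauge_both_translation: "gauge_both (t h) - t h \<in> J"
proof (rule can_inject)
  have "can (gauge_both u) - tensor_left \<Phi> (can u) \<in> K" for u
  proof (rule hom_cong_modulo[OF module_hom_compose[OF module_hom_gauge_both module_hom_can,
          unfolded o_def] module_hom_compose[OF module_hom_can module_hom_tensor_left,
          unfolded o_def] subspace_tensor_null])
    fix p :: "'a \<times> 'a"
    obtain x y where p: "p = (x, y)" by fastforce
    show "can (gauge_both (fgen p)) - tensor_left \<Phi> (can (fgen p)) \<in> K"
      using tensor_left_mult_mem_null[OF coaction_rep_gauge, of "\<Phi> x" y]
      by (simp add: p gauge_both_def tensor_left_diff tensor_left_tensor_left o_def gauge_mult)
  qed
  moreover have "tensor_left \<Phi> (can (t h)) - fgen (1, h) \<in> K"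
    using tensor_left_gauge_mem_null[OF can_translation[of h]]
    by (simp add: tensor_left_diff gauge_one)
  moreover have "fgen (1, h) - can (t h) \<in> K"
    by (rule modulo_sym[OF subspace_tensor_null can_translation])
  ultimately show "can (gauge_both (t h)) - can (t h) \<in> K"
    by (blast intro: modulo_trans[OF subspace_tensor_null])
qed

text \<open>
  By multiplicativity \<open>\<Phi> (\<Phi> a' a'') = \<Phi> (\<Phi> a') \<Phi> a''\<close>, the image of \<open>\<Phi> a' \<otimes> \<Phi> a''\<close> under the
  same map; and \<open>\<Phi> \<otimes> \<Phi>\<close> fixes the translation map.
\<close>

lemma gauge_mult_gauge_translation: "\<Phi> (mult_gauge (t h)) = mult_gauge (t h)"
proof -
  have "\<Phi> (mult_gauge u) = mult_gauge (gauge_both u)" for u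
    by (rule hom_eqI[OF module_hom_compose[OF module_hom_mult_gauge module_hom_gauge,
          unfolded o_def] module_hom_compose[OF module_hom_gauge_both module_hom_mult_gauge,
          unfolded o_def]])
      (auto simp: mult_gauge_fgen gauge_both_def gauge_mult)
  then show ?thesis by (simp add: mult_gauge_cong[OF gauge_both_translation])
qed

text \<open>Apply \<open>a' \<otimes> a'' \<mapsto> \<Phi> a' a''\<close> to \<open>a\<^bsub>(0)\<^esub> a\<^bsub>(1)\<^esub>\<^sup><\<^sup>1\<^sup>> \<otimes> a\<^bsub>(1)\<^esub>\<^sup><\<^sup>2\<^sup>> = 1 \<otimes> a\<close>.\<close>

lemma gauge_coaction_translation:
  "lin_ext sA (\<lambda>(x, h). \<Phi> x * mult_gauge (t h)) (d a) = a"
proof -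
  let ?R = "lin_ext fscale (\<lambda>(x, h). tensor_left ((*) x) (t h))"
  have "lin_ext sA (\<lambda>(x, h). \<Phi> x * mult_gauge (t h)) w = mult_gauge (?R w)" for w
    by (rule hom_eqI[OF module_hom_lin_ext[OF A.module_axioms]
          module_hom_compose[OF module_hom_fscale module_hom_mult_gauge, unfolded o_def]])
      (auto simp: lin_ext_fgen[OF A.module_axioms] mult_gauge_tensor_left)
  then show ?thesis
    by (simp add: mult_gauge_cong[OF coaction_translation] mult_gauge_fgen gauge_one)
qed

lemma gauge_inverse_eq:
  "gauge_inverse sA sH \<delta> \<Phi> a = lin_ext sA (\<lambda>(x, h). x * mult_gauge (t h)) (d a)"
  by (simp add: gauge_inverse_def tensor_lift_def mult_gauge_def)

lemma gauge_gauge_inverse: "\<Phi> (gauge_inverse sA sH \<delta> \<Phi> a) = a"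
proof -
  have "\<Phi> (lin_ext sA (\<lambda>(x, h). x * mult_gauge (t h)) w)
      = lin_ext sA (\<lambda>(x, h). \<Phi> x * mult_gauge (t h)) w" for w
    by (rule hom_eqI[OF module_hom_compose[OF module_hom_lin_ext[OF A.module_axioms]
            module_hom_gauge, unfolded o_def] module_hom_lin_ext[OF A.module_axioms]])
      (auto simp: lin_ext_fgen[OF A.module_axioms] gauge_mult gauge_mult_gauge_translation)
  then show ?thesis by (simp add: gauge_inverse_eq gauge_coaction_translation)
qed

text \<open>
  The comodule map property identifies \<open>\<delta> (\<Phi> a)\<close> with \<open>\<Phi> (a\<^bsub>(0)\<^esub>) \<otimes> a\<^bsub>(1)\<^esub>\<close> only up to relations, so the
  map \<open>x \<otimes> h \<mapsto> x \<Phi> (h\<^sup><\<^sup>1\<^sup>>) h\<^sup><\<^sup>2\<^sup>>\<close> has to be bilinear.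
\<close>

lemma gauge_inverse_gauge: "gauge_inverse sA sH \<delta> \<Phi> (\<Phi> a) = a"
proof -
  let ?\<Psi> = "lin_ext sA (\<lambda>(x, h). x * mult_gauge (t h))"
  interpret M: module_hom fscale sA mult_gauge by (rule module_hom_mult_gauge)
  interpret module_hom fscale sA ?\<Psi> by (rule module_hom_lin_ext[OF A.module_axioms])
  have "mult_gauge (t (h + h')) = mult_gauge (t h) + mult_gauge (t h')"
    "mult_gauge (t (sH r h)) = sA r (mult_gauge (t h))" for h h' r
    using mult_gauge_cong[OF translation_rep_add] mult_gauge_cong[OF translation_rep_scale]
    by (simp_all add: M.add M.scale)
  then have "bilinear_modulo sA sH sA {0} (\<lambda>x h. x * mult_gauge (t h))"
    by (simp add: bilinear_modulo_def algebra_simps A.scale_mult_left A.scale_mult_right)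
  from lin_ext_tensor_null[OF A.module_axioms _ this coaction_rep_gauge[of a]]
  have "?\<Psi> (d (\<Phi> a)) = ?\<Psi> (tensor_left \<Phi> (d a))"
    by (simp add: diff)
  also have "\<dots> = lin_ext sA (\<lambda>(x, h). \<Phi> x * mult_gauge (t h)) (d a)"
    by (rule hom_eqI[OF module_hom_compose[OF module_hom_tensor_left module_hom_axioms,
            unfolded o_def] module_hom_lin_ext[OF A.module_axioms]])
      (auto simp: lin_ext_fgen[OF A.module_axioms])
  finally show ?thesis by (simp add: gauge_inverse_eq gauge_coaction_translation)
qed

end

section \<open>The group of gauge transformations\<close>

lemma comodule_map_iff:
  "comodule_map sA sH \<delta> \<Phi> \<longleftrightarrow> (\<forall>a. \<delta> (\<Phi> a) = cls K (tensor_left \<Phi> (d a)))"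
  by (simp add: comodule_map_def quot_lift_def tensor_lift_def tensor_left_def)

lemma id_in_Aut_B: "id \<in> Aut_B sA sH \<delta>"
  by (simp add: Aut_B_def algebra_map_def comodule_map_iff id_def tensor_left_ident cls_rep_coaction)

lemma comp_in_Aut_B:
  assumes "\<Phi> \<in> Aut_B sA sH \<delta>" and "\<Psi> \<in> Aut_B sA sH \<delta>"
  shows "\<Psi> \<circ> \<Phi> \<in> Aut_B sA sH \<delta>"
proof -
  have "\<delta> (\<Psi> (\<Phi> a)) = cls K (tensor_left (\<Psi> \<circ> \<Phi>) (d a))" for a
  proof -
    have "\<delta> (\<Psi> (\<Phi> a)) = cls K (tensor_left \<Psi> (d (\<Phi> a)))"
      using assms(2) by (simp add: Aut_B_def comodule_map_iff)
    also have "\<dots> = cls K (tensor_left \<Psi> (tensor_left \<Phi> (d a)))"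
      unfolding cls_eq_iff[OF subspace_tensor_null] tensor_left_diff[symmetric]
      by (intro tensor_left_gauge_mem_null coaction_rep_gauge assms)
    finally show ?thesis by (simp add: tensor_left_tensor_left)
  qed
  then show ?thesis
    using assms by (auto simp: Aut_B_def algebra_map_def comodule_map_iff)
qed

text \<open>
  All properties transfer along the bijection \<open>\<Phi>\<close>. For the coaction, apply \<open>\<Psi> \<otimes> id\<close> to
  \<open>\<delta> (\<Phi> (\<Psi> a)) = (\<Phi> \<otimes> id) (\<delta> (\<Psi> a))\<close>, where \<open>\<Psi>\<close> is the inverse of \<open>\<Phi>\<close>.
\<close>

lemma gauge_inverse_in_Aut_B:
  assumes \<Phi>: "\<Phi> \<in> Aut_B sA sH \<delta>"
  shows "gauge_inverse sA sH \<delta> \<Phi> \<in> Aut_B sA sH \<delta>"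
proof -
  let ?\<Psi> = "gauge_inverse sA sH \<delta> \<Phi>"
  note inverse = gauge_gauge_inverse[OF \<Phi>] gauge_inverse_gauge[OF \<Phi>]
  have \<Psi>I: "?\<Psi> x = y" if "\<Phi> y = x" for x y
    using that inverse(2) by auto
  have add: "?\<Psi> (x + y) = ?\<Psi> x + ?\<Psi> y" and scale: "?\<Psi> (sA r x) = sA r (?\<Psi> x)" for x y r
    by (intro \<Psi>I; simp add: gauge_add[OF \<Phi>] gauge_scale[OF \<Phi>] inverse)+
  have "algebra_map sA sA ?\<Psi>"
    unfolding algebra_map_def
    by (intro conjI allI \<Psi>I)
      (simp_all add: gauge_add[OF \<Phi>] gauge_scale[OF \<Phi>] gauge_mult[OF \<Phi>] gauge_one[OF \<Phi>] inverse)
  moreover have "\<delta> (?\<Psi> a) = cls K (tensor_left ?\<Psi> (d a))" for a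
  proof -
    have "tensor_left ?\<Psi> (d (\<Phi> (?\<Psi> a)) - tensor_left \<Phi> (d (?\<Psi> a))) \<in> K"
      by (rule tensor_left_mem_null[OF add scale coaction_rep_gauge[OF \<Phi>]])
    then have "tensor_left ?\<Psi> (d a) - d (?\<Psi> a) \<in> K"
      by (simp add: tensor_left_diff tensor_left_tensor_left o_def inverse tensor_left_ident)
    then have "cls K (tensor_left ?\<Psi> (d a)) = cls K (d (?\<Psi> a))"
      by (simp add: cls_eq_iff)
    then show ?thesis by (simp add: cls_rep_coaction)
  qed
  moreover have "?\<Psi> b = b" if "b \<in> B" for b
    using that by (intro \<Psi>I gauge_coinvariant[OF \<Phi>])
  ultimately show ?thesis by (simp add: Aut_B_def comodule_map_iff)
qed

lemma group_Aut_B: "group (Aut_B_group sA sH \<delta>)"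
proof (rule groupI)
  fix \<Phi> assume "\<Phi> \<in> carrier (Aut_B_group sA sH \<delta>)"
  then show "\<exists>\<Psi>\<in>carrier (Aut_B_group sA sH \<delta>).
      \<Psi> \<otimes>\<^bsub>Aut_B_group sA sH \<delta>\<^esub> \<Phi> = \<one>\<^bsub>Aut_B_group sA sH \<delta>\<^esub>"
    by (intro bexI[of _ "gauge_inverse sA sH \<delta> \<Phi>"])
      (auto simp: Aut_B_group_def gauge_inverse_in_Aut_B gauge_gauge_inverse)
qed (auto simp: Aut_B_group_def id_in_Aut_B comp_in_Aut_B comp_assoc)

lemma inv_Aut_B_group:
  assumes "\<Phi> \<in> Aut_B sA sH \<delta>"
  shows "inv\<^bsub>Aut_B_group sA sH \<delta>\<^esub> \<Phi> = gauge_inverse sA sH \<delta> \<Phi>"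
  using assms
  by (intro group.inv_equality[OF group_Aut_B])
    (auto simp: Aut_B_group_def gauge_inverse_in_Aut_B gauge_gauge_inverse)

end

theorem theorem6p2:
  fixes sH :: "'k::comm_ring_1 \<Rightarrow> 'h \<Rightarrow> 'h::{ring, monoid_mult}"
    and \<Delta> :: "'h \<Rightarrow> ('h \<times> 'h \<Rightarrow>\<^sub>0 'k) set"
    and \<epsilon> :: "'h \<Rightarrow> 'k"
    and S :: "'h \<Rightarrow> 'h"
    and sA :: "'k \<Rightarrow> 'a \<Rightarrow> 'a::{ring, monoid_mult}"
    and \<delta> :: "'a \<Rightarrow> ('a \<times> 'h \<Rightarrow>\<^sub>0 'k) set"
  assumes base: "is_field TYPE('k) \<or> is_power_series_ring TYPE('k) TYPE('f::field)"
    and galois: "hopf_galois_extension sH \<Delta> \<epsilon> S sA \<delta>"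
  shows "group (Aut_B_group sA sH \<delta>) \<and>
    (\<forall>\<Phi> \<in> Aut_B sA sH \<delta>.
      inv\<^bsub>Aut_B_group sA sH \<delta>\<^esub> \<Phi> = gauge_inverse sA sH \<delta> \<Phi>)"
proof -
  interpret hopf_galois_extension sH \<Delta> \<epsilon> S sA \<delta> by (rule galois)
  show ?thesis using group_Aut_B inv_Aut_B_group by blast
qed

end
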